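(* Let $s\ge 1$. An $s$-stage exponential integrator $$Y_i=e^{c_i hM}y_0+h\sum_{j=1}^{s}\bar a_{ij}(hM)f(Y_j),\quad i=1,\dots,s,\qquad y_1=e^{hM}y_0+h\sum_{i=1}^{s}\bar b_i(hM)f(Y_i)$$ is symmetric if and only if its coefficients satisfy the following conditions: $$c_i=1-c_{s+1-i},\qquad i=1,\dots,s,$$ $$\bar a_{ij}(hM)=e^{c_i hM}\,\bar b_{s+1-j}(-hM)-\bar a_{s+1-i,\,s+1-j}(-hM),\qquad i,j=1,\dots,s,$$ $$\bar b_i(hM)=e^{hM}\,\bar b_{s+1-i}(-hM),\qquad i=1,\dots,s.$$
   Context: The integrators are for initial value problems $y'(t)=My(t)+f(y(t))$, $y(t_0)=y_0$, on $\mathbb{R}^d$, where $M$ is a $d\times d$ matrix, $f:\mathbb{R}^d\to\mathbb{R}^d$ is analytic, and $e^{tM}$ is the matrix exponential. An $s$-stage exponential integrator with stepsize $h$ is given by real constants $c_1,\dots,c_s$ (nodes) and matrix-valued functions $\bar a_{ij}(Z)$, $\bar b_i(Z)$ of a $d\times d$ matrix variable $Z$, evaluated at $Z=hM$, through the displayed stage and update equations; $y_0$ is the current value, $y_1$ the new value and $Y_i$ are the internal stages. Symmetry. In the scheme, exchange $y_0\leftrightarrow y_1$ and replace $h$ by $-h$, writing $\widehat Y_i$ for the resulting stages: $$\widehat Y_i=e^{-c_ihM}y_1-h\sum_{j=1}^s\bar a_{ij}(-hM)f(\widehat Y_j),\qquad y_0=e^{-hM}y_1-h\sum_{i=1}^s\bar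 b_i(-hM)f(\widehat Y_i).$$ Solve the last equation for $y_1$ and substitute it into the stage equations, so that $y_1$ and all $\widehat Y_i$ are expressed through $y_0$ and the $f(\widehat Y_j)$. The integrator is called symmetric if, with the stages renumbered in reverse order (i.e. $Y_i$ is identified with $\widehat Y_{s+1-i}$, $i=1,\dots,s$), the resulting scheme coincides with the original one, that is: the coefficients multiplying $y_0$ and each $f(Y_j)$ in every stage equation and in the update equation agree as functions of the matrix $Z=hM$. The conditions in the claim on $\bar a_{ij}(hM)$ and $\bar b_i(hM)$ are likewise understood as identities of functions of $Z=hM$ (with $-hM$ corresponding to $-Z$). *)

theory Defs
  imports "HOL-Analysis.Analysis"
begin

text \<open>Powers are iterated matrix products: the operations \<open>*\<close> and \<open>^\<close> on the
  type of matrices, and hence \<open>exp\<close>, would act entrywise.\<close>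

definition matrix_exp :: "real^'d^'d \<Rightarrow> real^'d^'d" where
  "matrix_exp A = (\<Sum>k. (1 / fact k) *\<^sub>R (((**) A ^^ k) (mat 1)))"

text \<open>One-step schemes
  \<open>Y\<^sub>i = P\<^sub>i(hM) y\<^sub>0 + h \<Sum>\<^sub>j A\<^sub>i\<^sub>j(hM) f(Y\<^sub>j)\<close>,
  \<open>y\<^sub>1 = Q(hM) y\<^sub>0 + h \<Sum>\<^sub>i B\<^sub>i(hM) f(Y\<^sub>i)\<close>
  with arbitrary matrix functions as coefficients. The fields hold \<open>P\<close>, \<open>A\<close>, \<open>Q\<close>, \<open>B\<close>;
  only the stage indices \<open>1, \<dots>, s\<close> matter.\<close>

record 'd scheme =
  stage_y :: "nat \<Rightarrow> real^'d^'d \<Rightarrow> real^'d^'d"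
  stage_f :: "nat \<Rightarrow> nat \<Rightarrow> real^'d^'d \<Rightarrow> real^'d^'d"
  update_y :: "real^'d^'d \<Rightarrow> real^'d^'d"
  update_f :: "nat \<Rightarrow> real^'d^'d \<Rightarrow> real^'d^'d"

definition scheme_eqs ::
  "nat \<Rightarrow> ('d::finite) scheme \<Rightarrow> real \<Rightarrow> real^'d^'d \<Rightarrow> (real^'d \<Rightarrow> real^'d) \<Rightarrow>
   real^'d \<Rightarrow> (nat \<Rightarrow> real^'d) \<Rightarrow> real^'d \<Rightarrow> bool" where
  "scheme_eqs s S h M f y0 Y y1 \<longleftrightarrow>
     (\<forall>i\<in>{1..s}. Y i = stage_y S i (h *\<^sub>R M) *v y0
        + h *\<^sub>R (\<Sum>j=1..s. stage_f S i j (h *\<^sub>R M) *v f (Y j))) \<and>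
     y1 = update_y S (h *\<^sub>R M) *v y0
        + h *\<^sub>R (\<Sum>i=1..s. update_f S i (h *\<^sub>R M) *v f (Y i))"

definition exponential_integrator ::
  "(nat \<Rightarrow> real) \<Rightarrow> (nat \<Rightarrow> nat \<Rightarrow> real^'d^'d \<Rightarrow> real^'d^'d) \<Rightarrow>
   (nat \<Rightarrow> real^'d^'d \<Rightarrow> real^'d^'d) \<Rightarrow> ('d::finite) scheme" where
  "exponential_integrator c a b =
     \<lparr> stage_y = (\<lambda>i Z. matrix_exp (c i *\<^sub>R Z)),
       stage_f = a,
       update_y = matrix_exp,
       update_f = b \<rparr>"

lemma exponential_integrator_eqs:
  "scheme_eqs s (exponential_integrator c a b) h M f y0 Y y1 \<longleftrightarrow>
     (\<forall>i\<in>{1..s}. Y i = matrix_exp ((c i * h) *\<^sub>R M) *v y0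
        + h *\<^sub>R (\<Sum>j=1..s. a i j (h *\<^sub>R M) *v f (Y j))) \<and>
     y1 = matrix_exp (h *\<^sub>R M) *v y0 + h *\<^sub>R (\<Sum>i=1..s. b i (h *\<^sub>R M) *v f (Y i))"
  by (simp add: scheme_eqs_def exponential_integrator_def)

text \<open>Exchanging \<open>y\<^sub>0\<close> and \<open>y\<^sub>1\<close> and replacing \<open>h\<close> by \<open>-h\<close>. The result, read as a scheme
  from \<open>y\<^sub>1\<close> to \<open>y\<^sub>0\<close>, is again written with a factor \<open>h\<close> in front of the sums, so that the
  sign moves into the coefficients.\<close>

definition exchange :: "('d::finite) scheme \<Rightarrow> 'd scheme" where
  "exchange S =
     \<lparr> stage_y = (\<lambda>i Z. stage_y S i (- Z)),
       stage_f = (\<lambda>i j Z. - stage_f S i j (- Z)),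
       update_y = (\<lambda>Z. update_y S (- Z)),
       update_f = (\<lambda>i Z. - update_f S i (- Z)) \<rparr>"

lemma matrix_vector_mult_uminus:
  fixes A :: "real^'n^'m"
  shows "(- A) *v x = - (A *v x)"
  using matrix_vector_mult_diff_rdistrib[of 0 A x] by simp

lemma exchange_eqs:
  "scheme_eqs s (exchange S) h M f y1 Y y0 \<longleftrightarrow> scheme_eqs s S (- h) M f y1 Y y0"
  by (simp add: scheme_eqs_def exchange_def matrix_vector_mult_uminus sum_negf)

text \<open>Solving the update equation \<open>y\<^sub>0 = Q y\<^sub>1 + h \<Sum>\<^sub>i B\<^sub>i f(Y\<^sub>i)\<close> of a scheme from \<open>y\<^sub>1\<close> to
  \<open>y\<^sub>0\<close> for \<open>y\<^sub>1\<close> and substituting the result into the stage equations.\<close>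

definition solve_update :: "('d::finite) scheme \<Rightarrow> 'd scheme" where
  "solve_update S =
     \<lparr> stage_y = (\<lambda>i Z. stage_y S i Z ** matrix_inv (update_y S Z)),
       stage_f = (\<lambda>i j Z. stage_f S i j Z
                    - stage_y S i Z ** matrix_inv (update_y S Z) ** update_f S j Z),
       update_y = (\<lambda>Z. matrix_inv (update_y S Z)),
       update_f = (\<lambda>i Z. - (matrix_inv (update_y S Z) ** update_f S i Z)) \<rparr>"

lemma matrix_vector_mult_sum_right:
  fixes A :: "real^'n^'m"
  shows "A *v (\<Sum>i\<in>I. g i) = (\<Sum>i\<in>I. A *v g i)"
  by (induction I rule: infinite_finite_induct) (simp_all add: matrix_vector_right_distrib)

lemma solve_update_eqs:
  fixes S :: "('d::finite) scheme"
  assumes "invertible (update_y S (h *\<^sub>R M))"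
  shows "scheme_eqs s (solve_update S) h M f y0 Y y1 \<longleftrightarrow> scheme_eqs s S h M f y1 Y y0"
proof -
  let ?Z = "h *\<^sub>R M"
  let ?Q = "update_y S ?Z"
  let ?R = "matrix_inv ?Q"
  let ?b = "h *\<^sub>R (\<Sum>i=1..s. update_f S i ?Z *v f (Y i))"
  have Q: "?R ** ?Q = mat 1" "?Q ** ?R = mat 1"
    using assms unfolding invertible_def matrix_inv_def by (rule someI2_ex, blast)+
  have RQ: "?R *v (?Q *v x) = x" "?Q *v (?R *v x) = x" for x
    by (simp_all add: Q matrix_vector_mul_assoc)
  have upd: "update_y (solve_update S) ?Z *v y0
      + h *\<^sub>R (\<Sum>i=1..s. update_f (solve_update S) i ?Z *v f (Y i)) = ?R *v (y0 - ?b)"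
    by (simp add: solve_update_def matrix_vector_mult_uminus sum_negf matrix_vector_mult_diff_distrib
        matrix_vector_mult_scaleR matrix_vector_mult_sum_right flip: matrix_vector_mul_assoc)
  have stage: "stage_y (solve_update S) i ?Z *v y0
      + h *\<^sub>R (\<Sum>j=1..s. stage_f (solve_update S) i j ?Z *v f (Y j))
      = stage_y S i ?Z *v (?R *v (y0 - ?b)) + h *\<^sub>R (\<Sum>j=1..s. stage_f S i j ?Z *v f (Y j))" for i
    by (simp add: solve_update_def matrix_vector_mult_diff_rdistrib sum_subtractf
        matrix_vector_mult_diff_distrib matrix_vector_mult_scaleR matrix_vector_mult_sum_right
        scaleR_diff_right flip: matrix_vector_mul_assoc)
  have "y1 = ?R *v (y0 - ?b) \<longleftrightarrow> y0 = ?Q *v y1 + ?b"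
  proof
    assume y1: "y1 = ?R *v (y0 - ?b)"
    show "y0 = ?Q *v y1 + ?b"
      unfolding y1 RQ by simp
  next
    assume "y0 = ?Q *v y1 + ?b"
    then have "y0 - ?b = ?Q *v y1"
      by (simp only: add_diff_cancel_right')
    then show "y1 = ?R *v (y0 - ?b)"
      by (simp only: RQ)
  qed
  then show ?thesis
    unfolding scheme_eqs_def upd stage by auto
qed

definition reverse_stages :: "nat \<Rightarrow> ('d::finite) scheme \<Rightarrow> 'd scheme" where
  "reverse_stages s S =
     \<lparr> stage_y = (\<lambda>i. stage_y S (s + 1 - i)),
       stage_f = (\<lambda>i j. stage_f S (s + 1 - i) (s + 1 - j)),
       update_y = update_y S,
       update_f = (\<lambda>i. update_f S (s + 1 - i)) \<rparr>"

lemma reverse_stages_eqs: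
  "scheme_eqs s (reverse_stages s S) h M f y0 (\<lambda>i. Y (s + 1 - i)) y1 \<longleftrightarrow>
   scheme_eqs s S h M f y0 Y y1"
proof -
  have bij: "bij_betw (\<lambda>i. s + 1 - i) {1..s} {1..s}"
    by (rule bij_betw_byWitness[where f' = "\<lambda>i. s + 1 - i"]) auto
  have sum: "(\<Sum>i=1..s. g (s + 1 - i)) = (\<Sum>i=1..s. g i)" for g :: "nat \<Rightarrow> real^'a"
    using bij by (rule sum.reindex_bij_betw)
  have all: "(\<forall>i\<in>{1..s}. P (s + 1 - i)) \<longleftrightarrow> (\<forall>i\<in>{1..s}. P i)" for P
    using bij_betw_imp_surj_on[OF bij] by (metis (mono_tags, lifting) image_iff)
  show ?thesis
    unfolding scheme_eqs_def reverse_stages_def scheme.simps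
      sum[of "\<lambda>j. stage_f S _ j _ *v f (Y j)"] sum[of "\<lambda>j. update_f S j _ *v f (Y j)"]
      all[of "\<lambda>i. Y i = stage_y S i _ *v y0 + h *\<^sub>R (\<Sum>j=1..s. stage_f S i j _ *v f (Y j))"] ..
qed

definition same_scheme :: "nat \<Rightarrow> ('d::finite) scheme \<Rightarrow> 'd scheme \<Rightarrow> bool" where
  "same_scheme s S T \<longleftrightarrow>
     (\<forall>i\<in>{1..s}. stage_y S i = stage_y T i) \<and>
     (\<forall>i\<in>{1..s}. \<forall>j\<in>{1..s}. stage_f S i j = stage_f T i j) \<and>
     update_y S = update_y T \<and>
     (\<forall>i\<in>{1..s}. update_f S i = update_f T i)"

definition symmetric_scheme :: "nat \<Rightarrow> ('d::finite) scheme \<Rightarrow> bool" where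
  "symmetric_scheme s S \<longleftrightarrow> same_scheme s (reverse_stages s (solve_update (exchange S))) S"

end

theory Submission
  imports Defs
begin

text \<open>
  Once the three operations that define the adjoint scheme are carried out on an exponential
  integrator, everything reduces to two facts about the matrix exponential. The first is the
  functional equation \<open>exp (x Z) exp (y Z) = exp ((x + y) Z)\<close>
  (\<open>matrix_exp_scaleR_add\<close>): it gives \<open>exp (-Z)\<inverse> = exp Z\<close> and
  \<open>exp (-c\<^sub>i Z) exp Z = exp ((1 - c\<^sub>i) Z)\<close>, so the reversed adjoint is again an exponential
  integrator, with nodes \<open>1 - c\<^sub>s\<^sub>+\<^sub>1\<^sub>-\<^sub>i\<close>, stage coefficients
  \<open>exp ((1 - c\<^sub>s\<^sub>+\<^sub>1\<^sub>-\<^sub>i) Z) b\<^sub>s\<^sub>+\<^sub>1\<^sub>-\<^sub>j(-Z) - a\<^sub>s\<^sub>+\<^sub>1\<^sub>-\<^sub>i\<^sub>,\<^sub>s\<^sub>+\<^sub>1\<^sub>-\<^sub>j(-Z)\<close> and update coefficients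
  \<open>exp Z b\<^sub>s\<^sub>+\<^sub>1\<^sub>-\<^sub>i(-Z)\<close> (\<open>adjoint_exponential_integrator\<close>).
  The second is that a node can be recovered from the function \<open>Z \<mapsto> exp (c Z)\<close>
  (\<open>matrix_exp_scaleR_inject\<close>), because at the identity matrix its value is \<open>e\<^sup>c\<close> times the
  identity. Hence equality of the two schemes means equality of their nodes and coefficients, and
  the node condition turns \<open>exp ((1 - c\<^sub>s\<^sub>+\<^sub>1\<^sub>-\<^sub>i) Z)\<close> into \<open>exp (c\<^sub>i Z)\<close> in the
  condition on the stage coefficients.

  The functional equation is proved entry by entry: every entry of \<open>exp (x Z)\<close> is an absolutely
  convergent real power series in \<open>x\<close>, so the Cauchy product of real series and the binomial
  theorem apply.
\<close>

abbreviation matrix_power :: "real^'d^'d \<Rightarrow> nat \<Rightarrow> real^'d^'d" where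
  "matrix_power A k \<equiv> ((**) A ^^ k) (mat 1)"

lemma matrix_power_add:
  "matrix_power A (m + n) = matrix_power A m ** matrix_power A n"
  by (induction m) (simp_all add: matrix_mul_assoc)

lemma matrix_power_scaleR:
  fixes A :: "real^'d^'d"
  shows "matrix_power (x *\<^sub>R A) k = x ^ k *\<^sub>R matrix_power A k"
  by (induction k)
    (simp_all add: matrix_scalar_ac mult.commute flip: scalar_matrix_assoc)

lemma matrix_power_mat_1: "matrix_power (mat 1) k = mat 1"
  by (induction k) simp_all

text \<open>The sum of the absolute values of all entries dominates every row sum, which makes it
  a bound that is preserved by multiplication with \<open>A\<close>.\<close>

lemma abs_matrix_power_nth_le:
  fixes A :: "real^'d^'d"
  shows "\<bar>matrix_power A k $ i $ j\<bar> \<le> (\<Sum>p\<in>UNIV. \<Sum>q\<in>UNIV. \<bar>A $ p $ q\<bar>) ^ k"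
proof (induction k arbitrary: i)
  case 0
  show ?case by (simp add: mat_def)
next
  case (Suc k)
  let ?C = "\<Sum>p\<in>UNIV. \<Sum>q\<in>UNIV. \<bar>A $ p $ q\<bar>"
  have "\<bar>matrix_power A (Suc k) $ i $ j\<bar> \<le> (\<Sum>l\<in>UNIV. \<bar>A $ i $ l * matrix_power A k $ l $ j\<bar>)"
    by (simp add: matrix_matrix_mult_def sum_abs)
  also have "\<dots> \<le> (\<Sum>l\<in>UNIV. \<bar>A $ i $ l\<bar> * ?C ^ k)"
    unfolding abs_mult by (intro sum_mono mult_left_mono Suc.IH abs_ge_zero)
  also have "\<dots> = (\<Sum>l\<in>UNIV. \<bar>A $ i $ l\<bar>) * ?C ^ k"
    by (simp add: sum_distrib_right)
  also have "\<dots> \<le> ?C * ?C ^ k"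
    by (intro mult_right_mono member_le_sum[of i UNIV "\<lambda>p. \<Sum>q\<in>UNIV. \<bar>A $ p $ q\<bar>"])
      (auto intro!: sum_nonneg zero_le_power)
  finally show ?case by simp
qed

lemma summable_abs_matrix_exp_nth:
  fixes A :: "real^'d^'d"
  shows "summable (\<lambda>k. \<bar>matrix_power A k $ i $ j / fact k\<bar>)"
proof (rule summable_comparison_test)
  let ?C = "\<Sum>p\<in>UNIV. \<Sum>q\<in>UNIV. \<bar>A $ p $ q\<bar>"
  show "\<exists>N. \<forall>k\<ge>N. norm \<bar>matrix_power A k $ i $ j / fact k\<bar> \<le> inverse (fact k) * ?C ^ k"
    using abs_matrix_power_nth_le[where A = A and i = i and j = j] by (auto simp: field_simps)
  show "summable (\<lambda>k. inverse (fact k) * ?C ^ k)"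
    by (rule summable_exp)
qed

lemma sums_matrixI:
  fixes f :: "nat \<Rightarrow> real^'d^'d"
  assumes "\<And>i j. (\<lambda>k. f k $ i $ j) sums (S $ i $ j)"
  shows "f sums S"
  using assms unfolding sums_def by (auto intro!: vec_tendstoI)

lemma matrix_exp_nth_sums:
  fixes A :: "real^'d^'d"
  shows "(\<lambda>k. matrix_power A k $ i $ j / fact k) sums (matrix_exp A $ i $ j)"
proof -
  let ?S = "\<chi> i j. \<Sum>k. matrix_power A k $ i $ j / fact k"
  have entry: "(\<lambda>k. matrix_power A k $ i $ j / fact k) sums (?S $ i $ j)" for i j
    using summable_rabs_cancel[OF summable_abs_matrix_exp_nth[of A i j]]
    by (simp add: summable_sums)
  have "(\<lambda>k. (1 / fact k) *\<^sub>R matrix_power A k) sums ?S"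
    using entry by (intro sums_matrixI) simp
  then have "matrix_exp A = ?S"
    unfolding matrix_exp_def by (simp add: sums_iff)
  with entry show ?thesis by simp
qed

lemma binomial_exp_terms:
  fixes x y :: real
  shows "(\<Sum>m\<le>k. x ^ m / fact m * (y ^ (k - m) / fact (k - m))) = (x + y) ^ k / fact k"
  unfolding binomial_ring sum_divide_distrib
  by (rule sum.cong) (simp_all add: binomial_fact)

text \<open>For a fixed row, column and intermediate index the product of the two entries is a Cauchy
  product of real series; summing its terms over the intermediate index turns
  \<open>Z\<^sup>m\<close> and \<open>Z\<^sup>k\<^sup>-\<^sup>m\<close> into \<open>Z\<^sup>k\<close>, so that only the scalar binomial sum is left.\<close>

lemma matrix_exp_scaleR_add:
  fixes Z :: "real^'d^'d"
  shows "matrix_exp (x *\<^sub>R Z) ** matrix_exp (y *\<^sub>R Z) = matrix_exp ((x + y) *\<^sub>R Z)"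
proof -
  have "(matrix_exp (x *\<^sub>R Z) ** matrix_exp (y *\<^sub>R Z)) $ i $ j
      = matrix_exp ((x + y) *\<^sub>R Z) $ i $ j" for i j
  proof -
    define p where "p l k = matrix_power (x *\<^sub>R Z) k $ i $ l / fact k" for l k
    define q where "q l k = matrix_power (y *\<^sub>R Z) k $ l $ j / fact k" for l k
    have cauchy_term: "(\<Sum>l\<in>UNIV. \<Sum>m\<le>k. p l m * q l (k - m))
        = matrix_power ((x + y) *\<^sub>R Z) k $ i $ j / fact k" for k
    proof -
      have "(\<Sum>l\<in>UNIV. \<Sum>m\<le>k. p l m * q l (k - m)) = (\<Sum>m\<le>k. \<Sum>l\<in>UNIV. p l m * q l (k - m))"
        by (rule sum.swap)
      also have "\<dots> = (\<Sum>m\<le>k. x ^ m / fact m * (y ^ (k - m) / fact (k - m))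
          * (matrix_power Z m ** matrix_power Z (k - m)) $ i $ j)"
        by (simp add: p_def q_def matrix_power_scaleR matrix_matrix_mult_def sum_distrib_left mult_ac)
      also have "\<dots> = (\<Sum>m\<le>k. x ^ m / fact m * (y ^ (k - m) / fact (k - m))
          * matrix_power Z k $ i $ j)"
        by (intro sum.cong) (simp_all flip: matrix_power_add)
      also have "\<dots> = (x + y) ^ k / fact k * matrix_power Z k $ i $ j"
        by (simp only: binomial_exp_terms flip: sum_distrib_right)
      finally show ?thesis by (simp add: matrix_power_scaleR)
    qed
    have "(\<lambda>k. \<Sum>m\<le>k. p l m * q l (k - m)) sums
        (matrix_exp (x *\<^sub>R Z) $ i $ l * matrix_exp (y *\<^sub>R Z) $ l $ j)" for l
      using Cauchy_product_sums[of "p l" "q l"]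
        summable_abs_matrix_exp_nth[of "x *\<^sub>R Z" i l] summable_abs_matrix_exp_nth[of "y *\<^sub>R Z" l j]
        matrix_exp_nth_sums[of "x *\<^sub>R Z" i l] matrix_exp_nth_sums[of "y *\<^sub>R Z" l j]
      by (simp add: p_def q_def sums_iff)
    then have "(\<lambda>k. \<Sum>l\<in>UNIV. \<Sum>m\<le>k. p l m * q l (k - m)) sums
        (\<Sum>l\<in>UNIV. matrix_exp (x *\<^sub>R Z) $ i $ l * matrix_exp (y *\<^sub>R Z) $ l $ j)"
      by (intro sums_sum)
    then have "(\<lambda>k. matrix_power ((x + y) *\<^sub>R Z) k $ i $ j / fact k) sums
        ((matrix_exp (x *\<^sub>R Z) ** matrix_exp (y *\<^sub>R Z)) $ i $ j)"
      unfolding cauchy_term by (simp add: matrix_matrix_mult_def)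
    then show ?thesis
      using matrix_exp_nth_sums sums_unique2 by blast
  qed
  then show ?thesis by (simp add: vec_eq_iff)
qed

lemma matrix_exp_scaleR_mat_1: "matrix_exp (x *\<^sub>R mat 1) = exp x *\<^sub>R (mat 1 :: real^'d^'d)"
proof -
  have "matrix_exp (x *\<^sub>R mat 1) $ i $ j = exp x * (mat 1 :: real^'d^'d) $ i $ j" for i j
  proof (rule sums_unique2)
    show "(\<lambda>k. matrix_power (x *\<^sub>R (mat 1 :: real^'d^'d)) k $ i $ j / fact k) sums
        (matrix_exp (x *\<^sub>R mat 1) $ i $ j)"
      by (rule matrix_exp_nth_sums)
    show "(\<lambda>k. matrix_power (x *\<^sub>R (mat 1 :: real^'d^'d)) k $ i $ j / fact k) sums
        (exp x * (mat 1 :: real^'d^'d) $ i $ j)"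
      using sums_mult2[OF exp_converges[of x], of "(mat 1 :: real^'d^'d) $ i $ j"]
      by (simp add: matrix_power_scaleR matrix_power_mat_1 field_simps)
  qed
  then show ?thesis by (simp add: vec_eq_iff)
qed

lemma matrix_exp_scaleR_inject:
  "(\<forall>Z :: real^'d^'d. matrix_exp (x *\<^sub>R Z) = matrix_exp (y *\<^sub>R Z)) \<longleftrightarrow> x = y"
proof
  assume "\<forall>Z :: real^'d^'d. matrix_exp (x *\<^sub>R Z) = matrix_exp (y *\<^sub>R Z)"
  then have "exp x *\<^sub>R (mat 1 :: real^'d^'d) = exp y *\<^sub>R mat 1"
    by (metis matrix_exp_scaleR_mat_1)
  then have "exp x * (mat 1 :: real^'d^'d) $ i $ i = exp y * (mat 1 :: real^'d^'d) $ i $ i" for i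
    by (metis vector_scaleR_component real_scaleR_def)
  then show "x = y" by (simp add: mat_def)
qed simp

lemma matrix_inv_unique:
  fixes A :: "'a::semiring_1^'n^'n"
  assumes "A ** B = mat 1" "B ** A = mat 1"
  shows "matrix_inv A = B"
proof -
  have inv: "A ** matrix_inv A = mat 1 \<and> matrix_inv A ** A = mat 1"
    unfolding matrix_inv_def by (rule someI_ex) (use assms in blast)
  have "matrix_inv A = matrix_inv A ** (A ** B)"
    by (simp add: assms)
  also have "\<dots> = (matrix_inv A ** A) ** B"
    by (rule matrix_mul_assoc)
  also have "\<dots> = B"
    by (simp add: inv)
  finally show ?thesis .
qed

lemma matrix_inv_matrix_exp: "matrix_inv (matrix_exp (- Z)) = matrix_exp Z"
proof (rule matrix_inv_unique)
  have "matrix_exp (0 :: real^'d^'d) = mat 1"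
    using matrix_exp_scaleR_mat_1[of 0] by simp
  then show "matrix_exp (- Z) ** matrix_exp Z = mat 1" "matrix_exp Z ** matrix_exp (- Z) = mat 1"
    using matrix_exp_scaleR_add[of "-1" Z 1] matrix_exp_scaleR_add[of 1 Z "-1"] by simp_all
qed

lemma matrix_mult_uminus_right:
  fixes A :: "real^'n^'m" and B :: "real^'p^'n"
  shows "A ** (- B) = - (A ** B)"
  by (simp add: matrix_matrix_mult_def vec_eq_iff sum_negf)

text \<open>The substitution step multiplies \<open>exp (-c\<^sub>i Z)\<close> by the inverse \<open>exp Z\<close> of the factor
  of the old \<open>y\<^sub>1\<close>, which is why the nodes become \<open>1 - c\<^sub>i\<close>; the two sign changes of
  \<open>b\<close>, from \<open>h \<mapsto> -h\<close> and from solving for \<open>y\<^sub>1\<close>, cancel.\<close>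

lemma adjoint_exponential_integrator:
  fixes a :: "nat \<Rightarrow> nat \<Rightarrow> real^'d^'d \<Rightarrow> real^'d^'d"
  shows "solve_update (exchange (exponential_integrator c a b))
   = exponential_integrator (\<lambda>i. 1 - c i)
       (\<lambda>i j Z. matrix_exp ((1 - c i) *\<^sub>R Z) ** b j (- Z) - a i j (- Z))
       (\<lambda>i Z. matrix_exp Z ** b i (- Z))"
proof -
  have "matrix_exp (- (c i *\<^sub>R Z)) ** matrix_exp Z = matrix_exp ((1 - c i) *\<^sub>R Z)"
    for i and Z :: "real^'d^'d"
    using matrix_exp_scaleR_add[of "- c i" Z 1] by (simp add: add.commute)
  then show ?thesis
    by (simp add: solve_update_def exchange_def exponential_integrator_def matrix_inv_matrix_exp
        matrix_mult_uminus_right)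
qed

lemma reverse_stages_exponential_integrator:
  "reverse_stages s (exponential_integrator c a b)
   = exponential_integrator (\<lambda>i. c (s + 1 - i)) (\<lambda>i j. a (s + 1 - i) (s + 1 - j))
       (\<lambda>i. b (s + 1 - i))"
  by (simp add: reverse_stages_def exponential_integrator_def)

lemma same_scheme_exponential_integrator:
  "same_scheme s (exponential_integrator c a b) (exponential_integrator c' a' b') \<longleftrightarrow>
    (\<forall>i\<in>{1..s}. c i = c' i) \<and>
    (\<forall>i\<in>{1..s}. \<forall>j\<in>{1..s}. a i j = a' i j) \<and>
    (\<forall>i\<in>{1..s}. b i = b' i)"
  by (simp add: same_scheme_def exponential_integrator_def fun_eq_iff matrix_exp_scaleR_inject)

theorem theorem2p3:
  fixes s :: nat
    and c :: "nat \<Rightarrow> real"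
    and a :: "nat \<Rightarrow> nat \<Rightarrow> real^'d^'d \<Rightarrow> real^'d^'d"
    and b :: "nat \<Rightarrow> real^'d^'d \<Rightarrow> real^'d^'d"
  assumes "s \<ge> 1"
  shows "symmetric_scheme s (exponential_integrator c a b) \<longleftrightarrow>
    (\<forall>i\<in>{1..s}. c i = 1 - c (s + 1 - i)) \<and>
    (\<forall>i\<in>{1..s}. \<forall>j\<in>{1..s}. \<forall>Z. a i j Z =
       matrix_exp (c i *\<^sub>R Z) ** b (s + 1 - j) (- Z) - a (s + 1 - i) (s + 1 - j) (- Z)) \<and>
    (\<forall>i\<in>{1..s}. \<forall>Z. b i Z = matrix_exp Z ** b (s + 1 - i) (- Z))"
proof -
  have "symmetric_scheme s (exponential_integrator c a b) \<longleftrightarrow>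
    (\<forall>i\<in>{1..s}. 1 - c (s + 1 - i) = c i) \<and>
    (\<forall>i\<in>{1..s}. \<forall>j\<in>{1..s}. \<forall>Z. matrix_exp ((1 - c (s + 1 - i)) *\<^sub>R Z) ** b (s + 1 - j) (- Z)
       - a (s + 1 - i) (s + 1 - j) (- Z) = a i j Z) \<and>
    (\<forall>i\<in>{1..s}. \<forall>Z. matrix_exp Z ** b (s + 1 - i) (- Z) = b i Z)"
    unfolding symmetric_scheme_def adjoint_exponential_integrator
      reverse_stages_exponential_integrator same_scheme_exponential_integrator fun_eq_iff ..
  \<comment> \<open>The node condition identifies \<open>1 - c (s + 1 - i)\<close> with \<open>c i\<close> in the second conjunct.\<close>
  then show ?thesis by (smt (verit))
qed

end
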